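(* Let $\mathcal E_i$, $i=1,2$, be nonlinear resistance forms on disjoint nonempty sets $X_i$, $i=1,2$, with $\ker\mathcal E_i\supset\mathbb R\cdot1$. For fixed $\xi_i\in X_i$, $i=1,2$, and $\varepsilon>0$ define $\mathcal E\colon\mathcal F(X_1\cup X_2)\to[0,\infty]$ by $$\mathcal E(f)=\mathcal E_1(f|_{X_1})+\mathcal E_2(f|_{X_2})+\frac1{4\varepsilon}|f(\xi_1)-f(\xi_2)|^2.$$ Then $\mathcal E$ is a nonlinear resistance form with $\ker\mathcal E\supset\mathbb R\cdot1$, and for $x_i\in X_i$, $i=1,2$, and $t>0$ we have $$\mathcal R_{t,\mathcal E}(x_1,x_2)=\mathcal R_{t,\mathcal E_1}(x_1,\xi_1)+\mathcal R_{t,\mathcal E_2}(\xi_2,x_2)+\varepsilon t^2.$$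
   Context: For a nonempty set $X$, $\mathcal F(X)$ is the real vector space of all functions $f\colon X\to\mathbb R$, equipped with the topology of pointwise convergence; $\mathbb R\cdot1$ denotes the constant functions. A functional $\mathcal E\colon\mathcal F(X)\to[0,\infty]$ is called a nonlinear resistance form (on $X$) if: (1) $\mathcal E$ is convex with $\mathcal E(0)=0$; (2) $\mathcal E$ is lower semicontinuous with respect to pointwise convergence, i.e. $\mathcal E(f)\le\liminf_i\mathcal E(f_i)$ for every net $f_i\to f$ pointwise; (3) $R(x,y)<\infty$ for all $x,y\in X$, where $R(x,y)=\sup\{f(x)-f(y)\mid\mathcal E(f)\le1\}$; (4) all normal contractions operate on $\mathcal E$, i.e. for every $1$-Lipschitz $C\colon\mathbb R\to\mathbb R$ with $C(0)=0$ and all $f,g\in\mathcal F(X)$, $\mathcal E(f+C\circ g)+\mathcal E(f-C\circ g)\le\mathcal E(f+g)+\mathcal E(f-g)$. $\ker\mathcal E=\{f\in\mathcal F(X)\mid\mathcal E(f)=0\}$. For $t>0$ and $x,y\in X$ the $t$-resistance of $\mathcal E$ is $\mathcal R_{t,\mathcal E}(x,y)=\sup\{t(f(x)-f(y))-\mathcal E(f)\mid f\in\mathcal F(X)\}\in[0,\infty]$. *)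

theory Defs
  imports "HOL-Analysis.Analysis"
begin

(* F(X): functions on the carrier set X, represented by their extensional extensions to the
   ambient type, so that two functions are equal iff they agree on X. This is the topspace of
   the product topology below. A functional on F(X) is a HOL function on 'a => real of which
   only the values on F(X) matter. *)
abbreviation fun_space :: "'a set \<Rightarrow> ('a \<Rightarrow> real) set" where
  "fun_space X \<equiv> X \<rightarrow>\<^sub>E UNIV"

abbreviation pointwise_topology :: "'a set \<Rightarrow> ('a \<Rightarrow> real) topology" where
  "pointwise_topology X \<equiv> product_topology (\<lambda>_. euclideanreal) X"

definition const_funs :: "'a set \<Rightarrow> ('a \<Rightarrow> real) set" where
  "const_funs X = range (\<lambda>c::real. \<lambda>x\<in>X. c)"

definition convex_functional :: "'a set \<Rightarrow> (('a \<Rightarrow> real) \<Rightarrow> ennreal) \<Rightarrow> bool" where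
  "convex_functional X E \<longleftrightarrow>
     (\<forall>f\<in>fun_space X. \<forall>g\<in>fun_space X. \<forall>s::real. 0 \<le> s \<and> s \<le> 1 \<longrightarrow>
        E (\<lambda>x\<in>X. s * f x + (1 - s) * g x) \<le> ennreal s * E f + ennreal (1 - s) * E g)"

(* Nets are expressed by filters on the function space itself: a net (f_i) enters through its
   eventuality filter filtermap f_i, and liminf E(f_i) is the Liminf of E along that filter. *)
definition lsc_functional :: "'a set \<Rightarrow> (('a \<Rightarrow> real) \<Rightarrow> ennreal) \<Rightarrow> bool" where
  "lsc_functional X E \<longleftrightarrow>
     (\<forall>(F :: ('a \<Rightarrow> real) filter) f.
        limitin (pointwise_topology X) (\<lambda>g. g) f F \<longrightarrow> E f \<le> Liminf F E)"

definition resistance :: "'a set \<Rightarrow> (('a \<Rightarrow> real) \<Rightarrow> ennreal) \<Rightarrow> 'a \<Rightarrow> 'a \<Rightarrow> ereal" where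
  "resistance X E x y = (SUP f\<in>{f \<in> fun_space X. E f \<le> 1}. ereal (f x - f y))"

definition contractions_operate :: "'a set \<Rightarrow> (('a \<Rightarrow> real) \<Rightarrow> ennreal) \<Rightarrow> bool" where
  "contractions_operate X E \<longleftrightarrow>
     (\<forall>C :: real \<Rightarrow> real. 1-lipschitz_on UNIV C \<and> C 0 = 0 \<longrightarrow>
        (\<forall>f\<in>fun_space X. \<forall>g\<in>fun_space X.
           E (\<lambda>x\<in>X. f x + C (g x)) + E (\<lambda>x\<in>X. f x - C (g x))
             \<le> E (\<lambda>x\<in>X. f x + g x) + E (\<lambda>x\<in>X. f x - g x)))"

definition nonlinear_resistance_form :: "'a set \<Rightarrow> (('a \<Rightarrow> real) \<Rightarrow> ennreal) \<Rightarrow> bool" where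
  "nonlinear_resistance_form X E \<longleftrightarrow>
     X \<noteq> {} \<and>
     convex_functional X E \<and> E (\<lambda>x\<in>X. 0) = 0 \<and>
     lsc_functional X E \<and>
     (\<forall>x\<in>X. \<forall>y\<in>X. resistance X E x y < \<infinity>) \<and>
     contractions_operate X E"

definition form_kernel :: "'a set \<Rightarrow> (('a \<Rightarrow> real) \<Rightarrow> ennreal) \<Rightarrow> ('a \<Rightarrow> real) set" where
  "form_kernel X E = {f \<in> fun_space X. E f = 0}"

(* The supremum is taken in ereal because single terms may be negative, or -\<infinity> where E f = \<infinity>;
   it is nonnegative as soon as E vanishes at the zero function. *)
definition t_resistance ::
    "'a set \<Rightarrow> (('a \<Rightarrow> real) \<Rightarrow> ennreal) \<Rightarrow> real \<Rightarrow> 'a \<Rightarrow> 'a \<Rightarrow> ereal" where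
  "t_resistance X E t x y =
     (SUP f\<in>fun_space X. ereal (t * (f x - f y)) - enn2ereal (E f))"

end

theory Submission
  imports Defs
begin

text \<open>
  Convexity, lower semicontinuity and the contraction property pass to sums and to pullbacks along
  restrictions, and the coupling term is a squared linear functional. For the resistances, write
  \<open>f x1 - f x2 = (f x1 - f \<xi>1) + (f \<xi>1 - f \<xi>2) + (f \<xi>2 - f x2)\<close>. The supremum defining the
  \<open>t\<close>-resistance then splits: each form is invariant under adding constants (by convexity and lower
  semicontinuity, since constants lie in its kernel), so the two restrictions and the gap
  \<open>f \<xi>1 - f \<xi>2\<close> can be chosen independently, and \<open>t d - d\<^sup>2 / (4 \<epsilon>)\<close> is maximal at \<open>d = 2 \<epsilon> t\<close>.
\<close>

section \<open>Superadditivity of lower limits\<close>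

text \<open>Each \<open>Liminf\<close> is a supremum of infima over eventual properties. These are
  directed under conjunction, so the sum of the two suprema is a single supremum over a common
  property. This lets lower semicontinuity pass to sums of functionals.\<close>

lemma Liminf_add_ge_ennreal:
  fixes f g :: "'a \<Rightarrow> ennreal"
  shows "Liminf F f + Liminf F g \<le> Liminf F (\<lambda>x. f x + g x)"
proof -
  let ?A = "{P. eventually P F}"
  let ?INF = "\<lambda>P h. INF x\<in>Collect P. (h x :: ennreal)"
  have "Liminf F f + Liminf F g = (SUP P\<in>?A. ?INF P f + ?INF P g)"
    unfolding Liminf_def
  proof (rule SUP_add_directed_ennreal[symmetric])
    fix P Q assume PQ: "P \<in> ?A" "Q \<in> ?A"
    show "\<exists>R\<in>?A. ?INF P f + ?INF Q g \<le> ?INF R f + ?INF R g"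
      using PQ by (intro bexI[of _ "\<lambda>x. P x \<and> Q x"] add_mono INF_superset_mono)
        (auto intro: eventually_conj)
  qed
  also have "\<dots> \<le> Liminf F (\<lambda>x. f x + g x)"
    unfolding Liminf_def
    by (intro SUP_mono) (fastforce intro!: INF_greatest add_mono INF_lower)
  finally show ?thesis .
qed

section \<open>Properties of a single form\<close>

lemma nonlinear_resistance_formD:
  assumes "nonlinear_resistance_form X E"
  shows "X \<noteq> {}" "convex_functional X E" "E (\<lambda>x\<in>X. 0) = 0" "lsc_functional X E"
    "contractions_operate X E"
    "x \<in> X \<Longrightarrow> y \<in> X \<Longrightarrow> resistance X E x y < \<infinity>"
  using assms unfolding nonlinear_resistance_form_def by blast+

lemma convex_functionalD:
  assumes "convex_functional X E" and "f \<in> fun_space X" and "g \<in> fun_space X"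
    and "0 \<le> s" and "s \<le> 1"
  shows "E (\<lambda>x\<in>X. s * f x + (1 - s) * g x) \<le> ennreal s * E f + ennreal (1 - s) * E g"
  using assms unfolding convex_functional_def by blast

lemma energy_const_eq_0:
  assumes "const_funs X \<subseteq> form_kernel X E"
  shows "E (\<lambda>x\<in>X. c) = 0"
proof -
  have "(\<lambda>x\<in>X. c) \<in> const_funs X" by (simp add: const_funs_def)
  with assms show ?thesis by (auto simp: form_kernel_def)
qed

text \<open>Trades the \<open>ereal\<close> supremum for a real bound, which can be chained along
  points. The zero function is an admissible competitor, so the supremum is not -\<infinity> and
  finiteness makes it a real number.\<close>

lemma resistance_finite_iff:
  assumes "E (\<lambda>x\<in>X. 0) = 0"
  shows "resistance X E x y < \<infinity> \<longleftrightarrow> (\<exists>M. \<forall>f\<in>fun_space X. E f \<le> 1 \<longrightarrow> f x - f y \<le> M)"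
proof
  assume fin: "resistance X E x y < \<infinity>"
  have le: "ereal (f x - f y) \<le> resistance X E x y" if "f \<in> fun_space X" "E f \<le> 1" for f
    unfolding resistance_def using that by (intro SUP_upper) auto
  have "resistance X E x y \<noteq> -\<infinity>"
    using le[of "\<lambda>x\<in>X. 0"] assms by auto
  with fin obtain M where "resistance X E x y = ereal M"
    by (cases "resistance X E x y") auto
  with le show "\<exists>M. \<forall>f\<in>fun_space X. E f \<le> 1 \<longrightarrow> f x - f y \<le> M"
    by auto
next
  assume "\<exists>M. \<forall>f\<in>fun_space X. E f \<le> 1 \<longrightarrow> f x - f y \<le> M"
  then obtain M where "\<forall>f\<in>fun_space X. E f \<le> 1 \<longrightarrow> f x - f y \<le> M" ..
  then have "resistance X E x y \<le> ereal M"
    unfolding resistance_def by (intro SUP_least) auto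
  then show "resistance X E x y < \<infinity>" by (cases "resistance X E x y") auto
qed

text \<open>Discarding functions of infinite energy makes every term of the supremum a real number.\<close>

lemma t_resistance_eq_SUP_finite:
  assumes "E (\<lambda>x\<in>X. 0) = 0"
  shows "t_resistance X E t x y =
    (SUP f\<in>{f \<in> fun_space X. E f < top}. ereal (t * (f x - f y) - enn2real (E f)))"
    (is "_ = Sup (?g ` ?D)")
proof (rule antisym)
  have eq: "ereal (t * (f x - f y)) - enn2ereal (E f) = ?g f" if "E f < top" for f
    using that by (cases "E f" rule: ennreal_cases) (auto simp: enn2ereal_ennreal)
  have zero: "(\<lambda>x\<in>X. 0) \<in> ?D" using assms by auto
  show "t_resistance X E t x y \<le> Sup (?g ` ?D)"
    unfolding t_resistance_def
  proof (rule SUP_least)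
    fix f assume f: "f \<in> fun_space X"
    show "ereal (t * (f x - f y)) - enn2ereal (E f) \<le> Sup (?g ` ?D)"
    proof (cases "E f < top")
      case True
      then show ?thesis unfolding eq[OF True] using f by (intro SUP_upper) auto
    next
      \<comment> \<open>Infinite energy turns the term into -\<infinity>, which cannot affect the
        supremum.\<close>
      case False
      then have "E f = top" using top.not_eq_extremum by blast
      then show ?thesis by simp
    qed
  qed
  show "Sup (?g ` ?D) \<le> t_resistance X E t x y"
    unfolding t_resistance_def
    by (intro SUP_least) (auto simp: eq[symmetric] intro!: SUP_upper)
qed

text \<open>For 0 < s < 1, \<open>s * f + c\<close> is the convex combination of \<open>f\<close>
  and the constant \<open>c / (1 - s)\<close>, which has zero energy; convexity bounds its energy by
  \<open>s * E f\<close>. Lower semicontinuity then allows s to tend to 1. Shifting back by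
  \<open>-c\<close> would give the reverse inequality.\<close>

lemma energy_add_const_le:
  assumes E: "convex_functional X E" "lsc_functional X E" "const_funs X \<subseteq> form_kernel X E"
    and f: "f \<in> fun_space X"
  shows "E (\<lambda>x\<in>X. f x + c) \<le> E f"
proof -
  let ?F = "at_left (1::real)"
  define h where "h s = (\<lambda>x\<in>X. s * f x + c)" for s :: real
  have h1: "h 1 = (\<lambda>x\<in>X. f x + c)" by (simp add: h_def)
  have lim: "limitin (pointwise_topology X) h (h 1) ?F"
    unfolding limitin_componentwise
  proof (intro conjI ballI)
    show "h 1 \<in> extensional X" by (simp add: h_def)
    show "\<forall>\<^sub>F s in ?F. h s \<in> topspace (pointwise_topology X)"
      by (simp add: h_def)
    fix x assume x: "x \<in> X"
    have "((\<lambda>s. s * f x + c) \<longlongrightarrow> 1 * f x + c) ?F"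
      by (intro tendsto_intros)
    with x show "limitin euclideanreal (\<lambda>s. h s x) (h 1 x) ?F"
      by (simp add: h_def limitin_canonical_iff)
  qed
  have le: "E (h s) \<le> E f" if s: "0 < s" "s < 1" for s
  proof -
    let ?k = "\<lambda>x\<in>X. c / (1 - s)"
    have k0: "E ?k = 0" by (rule energy_const_eq_0[OF E(3)])
    have "E (\<lambda>x\<in>X. s * f x + (1 - s) * ?k x) \<le> ennreal s * E f + ennreal (1 - s) * E ?k"
      using s by (intro convex_functionalD E f) auto
    also have "(\<lambda>x\<in>X. s * f x + (1 - s) * ?k x) = h s"
      using s by (auto simp: h_def fun_eq_iff)
    also have "ennreal s * E f + ennreal (1 - s) * E ?k = ennreal s * E f"
      by (simp add: k0)
    also have "\<dots> \<le> 1 * E f"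
      using s by (intro mult_right_mono) auto
    finally show ?thesis by simp
  qed
  \<comment> \<open>Lower semicontinuity is stated for filters on the function space, so the curve
    \<open>h\<close> is pushed forward to its image filter.\<close>
  have "limitin (pointwise_topology X) (\<lambda>g. g) (h 1) (filtermap h ?F)"
    using lim by (simp add: limitin_def eventually_filtermap)
  then have "E (h 1) \<le> Liminf (filtermap h ?F) E"
    using E(2) unfolding lsc_functional_def by blast
  also have "\<dots> \<le> Liminf ?F (\<lambda>s. E (h s))"
    by (rule Liminf_filtermap_le)
  also have "\<dots> \<le> Liminf ?F (\<lambda>_. E f)"
  proof (rule Liminf_mono)
    show "\<forall>\<^sub>F s in ?F. E (h s) \<le> E f"
      unfolding eventually_at_left_field using le by (intro exI[of _ 0]) auto
  qed
  also have "\<dots> = E f" by (simp add: Liminf_const)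
  finally show ?thesis unfolding h1 .
qed

section \<open>The coupled functional\<close>

locale coupled_forms =
  fixes X1 X2 :: "'a set"
    and E1 E2 E :: "('a \<Rightarrow> real) \<Rightarrow> ennreal"
    and \<xi>1 \<xi>2 :: 'a
    and \<epsilon> :: real
  assumes disj: "X1 \<inter> X2 = {}"
    and form1: "nonlinear_resistance_form X1 E1" and form2: "nonlinear_resistance_form X2 E2"
    and const1: "const_funs X1 \<subseteq> form_kernel X1 E1" and const2: "const_funs X2 \<subseteq> form_kernel X2 E2"
    and \<xi>1: "\<xi>1 \<in> X1" and \<xi>2: "\<xi>2 \<in> X2" and \<epsilon>: "\<epsilon> > 0"
    and E_eq: "f \<in> fun_space (X1 \<union> X2) \<Longrightarrow>
           E f = E1 (restrict f X1) + E2 (restrict f X2)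
                 + ennreal (1 / (4 * \<epsilon>) * \<bar>f \<xi>1 - f \<xi>2\<bar>\<^sup>2)"
begin

abbreviation "X \<equiv> X1 \<union> X2"

abbreviation coupling :: "real \<Rightarrow> real" where
  "coupling d \<equiv> 1 / (4 * \<epsilon>) * \<bar>d\<bar>\<^sup>2"

lemmas form1D = nonlinear_resistance_formD[OF form1]
lemmas form2D = nonlinear_resistance_formD[OF form2]

lemma coupling_nonneg: "0 \<le> coupling d"
  using \<epsilon> by simp

text \<open>The hypothesis \<open>E_eq\<close> speaks only about extensional functions. Written for
  \<open>restrict h X\<close> with arbitrary \<open>h\<close>, the decomposition applies without
  side conditions to the lambda terms in the axioms.\<close>

lemma E_restrict:
  "E (restrict h X) = E1 (restrict h X1) + E2 (restrict h X2) + ennreal (coupling (h \<xi>1 - h \<xi>2))"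
proof -
  have "X \<inter> X1 = X1" "X \<inter> X2 = X2" by auto
  then show ?thesis
    using \<xi>1 \<xi>2 by (subst E_eq) auto
qed

section \<open>The axioms of a nonlinear resistance form\<close>

lemma const_funs_subset: "const_funs X \<subseteq> form_kernel X E"
proof
  fix f assume "f \<in> const_funs X"
  then obtain c where f: "f = (\<lambda>x\<in>X. c)" by (auto simp: const_funs_def)
  show "f \<in> form_kernel X E"
    using energy_const_eq_0[OF const1] energy_const_eq_0[OF const2]
    by (simp add: f form_kernel_def E_restrict)
qed

lemma E_zero: "E (\<lambda>x\<in>X. 0) = 0"
  by (rule energy_const_eq_0[OF const_funs_subset])

lemma convex: "convex_functional X E"
  unfolding convex_functional_def
proof (intro ballI allI impI)
  fix f g s
  assume f: "f \<in> fun_space X" and g: "g \<in> fun_space X" and s: "0 \<le> s \<and> s \<le> (1::real)"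
  have conv: "Ei (\<lambda>x\<in>Y. s * f x + (1 - s) * g x)
      \<le> ennreal s * Ei (restrict f Y) + ennreal (1 - s) * Ei (restrict g Y)"
    if "convex_functional Y Ei" for Y and Ei :: "('a \<Rightarrow> real) \<Rightarrow> ennreal"
  proof -
    have "(\<lambda>x\<in>Y. s * f x + (1 - s) * g x)
        = (\<lambda>x\<in>Y. s * restrict f Y x + (1 - s) * restrict g Y x)"
      by auto
    then show ?thesis
      using convex_functionalD[OF that, of "restrict f Y" "restrict g Y" s] s by simp
  qed
  let ?a = "f \<xi>1 - f \<xi>2" and ?b = "g \<xi>1 - g \<xi>2"
  \<comment> \<open>Convexity of the square with its exact defect, which is nonnegative for s in
    [0, 1].\<close>
  have "(s * ?a + (1 - s) * ?b)\<^sup>2 = s * ?a\<^sup>2 + (1 - s) * ?b\<^sup>2 - s * (1 - s) * (?a - ?b)\<^sup>2"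
    by (simp add: power2_eq_square algebra_simps)
  also have "\<dots> \<le> s * ?a\<^sup>2 + (1 - s) * ?b\<^sup>2"
    using s by simp
  finally have "1 / (4 * \<epsilon>) * (s * ?a + (1 - s) * ?b)\<^sup>2
      \<le> 1 / (4 * \<epsilon>) * (s * ?a\<^sup>2 + (1 - s) * ?b\<^sup>2)"
    using \<epsilon> by (intro mult_left_mono) auto
  then have "coupling (s * ?a + (1 - s) * ?b) \<le> s * coupling ?a + (1 - s) * coupling ?b"
    by (simp add: algebra_simps add_divide_distrib diff_divide_distrib)
  then have "ennreal (coupling (s * ?a + (1 - s) * ?b))
      \<le> ennreal (s * coupling ?a + (1 - s) * coupling ?b)"
    by (rule ennreal_leI)
  also have "\<dots> = ennreal s * ennreal (coupling ?a) + ennreal (1 - s) * ennreal (coupling ?b)"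
    using s coupling_nonneg by (simp only: ennreal_plus ennreal_mult mult_nonneg_nonneg diff_ge_0_iff_ge)
  also have "s * ?a + (1 - s) * ?b
      = (s * f \<xi>1 + (1 - s) * g \<xi>1) - (s * f \<xi>2 + (1 - s) * g \<xi>2)"
    by (simp add: algebra_simps)
  finally have "E (\<lambda>x\<in>X. s * f x + (1 - s) * g x)
    \<le> (ennreal s * E1 (restrict f X1) + ennreal (1 - s) * E1 (restrict g X1))
    + (ennreal s * E2 (restrict f X2) + ennreal (1 - s) * E2 (restrict g X2))
    + (ennreal s * ennreal (coupling ?a) + ennreal (1 - s) * ennreal (coupling ?b))"
    unfolding E_restrict by (intro add_mono conv form1D form2D)
  also have "\<dots> = ennreal s * E f + ennreal (1 - s) * E g"
    unfolding E_eq[OF f] E_eq[OF g] by (simp only: distrib_left ac_simps)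
  finally show "E (\<lambda>x\<in>X. s * f x + (1 - s) * g x) \<le> ennreal s * E f + ennreal (1 - s) * E g" .
qed

text \<open>Restriction to a subset is continuous for pointwise convergence, so both pulled-back
  forms are lower semicontinuous. The coupling term is continuous, and
  \<open>Liminf_add_ge_ennreal\<close> combines the three.\<close>

lemma lsc: "lsc_functional X E"
  unfolding lsc_functional_def
proof (intro allI impI)
  fix F :: "('a \<Rightarrow> real) filter" and f
  assume lim: "limitin (pointwise_topology X) (\<lambda>g. g) f F"
  have f: "f \<in> fun_space X" and ev: "\<forall>\<^sub>F g in F. g \<in> fun_space X"
    and pt: "\<And>x. x \<in> X \<Longrightarrow> ((\<lambda>g. g x) \<longlongrightarrow> f x) F"
    using lim unfolding limitin_componentwise
    by (auto simp: PiE_UNIV_domain PiE_def limitin_canonical_iff)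
  have lsci: "Ei (restrict f Y) \<le> Liminf F (\<lambda>g. Ei (restrict g Y))"
    if "lsc_functional Y Ei" "Y \<subseteq> X" for Y and Ei :: "('a \<Rightarrow> real) \<Rightarrow> ennreal"
  proof -
    have "limitin (pointwise_topology Y) (\<lambda>g. restrict g Y) (restrict f Y) F"
      unfolding limitin_componentwise using pt that(2)
      by (auto simp: limitin_canonical_iff)
    then have "limitin (pointwise_topology Y) (\<lambda>g. g) (restrict f Y)
        (filtermap (\<lambda>g. restrict g Y) F)"
      by (simp add: limitin_def eventually_filtermap)
    then have "Ei (restrict f Y) \<le> Liminf (filtermap (\<lambda>g. restrict g Y) F) Ei"
      using that(1) unfolding lsc_functional_def by blast
    also have "\<dots> \<le> Liminf F (\<lambda>g. Ei (restrict g Y))"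
      by (rule Liminf_filtermap_le)
    finally show ?thesis .
  qed
  have coup: "ennreal (coupling (f \<xi>1 - f \<xi>2)) \<le> Liminf F (\<lambda>g. ennreal (coupling (g \<xi>1 - g \<xi>2)))"
  \<comment> \<open>Along a proper filter the limit equals the \<open>Liminf\<close>; along
    \<open>bot\<close> the \<open>Liminf\<close> is \<open>top\<close> and the claim is
    trivial.\<close>
  proof (cases "F = bot")
    case False
    have "((\<lambda>g. ennreal (coupling (g \<xi>1 - g \<xi>2))) \<longlongrightarrow> ennreal (coupling (f \<xi>1 - f \<xi>2))) F"
      using \<xi>1 \<xi>2 by (intro tendsto_ennrealI tendsto_intros pt) auto
    from lim_imp_Liminf[OF False this] show ?thesis by (rule eq_refl[OF sym])
  qed simp
  have "E f \<le> Liminf F (\<lambda>g. E1 (restrict g X1)) + Liminf F (\<lambda>g. E2 (restrict g X2))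
      + Liminf F (\<lambda>g. ennreal (coupling (g \<xi>1 - g \<xi>2)))"
    unfolding E_eq[OF f] by (intro add_mono lsci coup form1D form2D) auto
  also have "\<dots> \<le> Liminf F (\<lambda>g. E1 (restrict g X1) + E2 (restrict g X2)
      + ennreal (coupling (g \<xi>1 - g \<xi>2)))"
    by (intro order.trans[OF add_right_mono[OF Liminf_add_ge_ennreal] Liminf_add_ge_ennreal])
  also have "\<dots> \<le> Liminf F E"
    by (intro Liminf_mono eventually_mono[OF ev]) (simp add: E_eq)
  finally show "E f \<le> Liminf F E" .
qed

text \<open>The inequality is additive over the three summands. For the coupling, \<open>(a +
  c)\<^sup>2 + (a - c)\<^sup>2 = 2 * a\<^sup>2 + 2 * c\<^sup>2\<close> is monotone in |c|, and a
  1-Lipschitz \<open>C\<close> does not enlarge the gap of \<open>g\<close> between \<xi>1 and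
  \<xi>2.\<close>

lemma contractions: "contractions_operate X E"
  unfolding contractions_operate_def
proof (intro allI impI ballI)
  fix C :: "real \<Rightarrow> real" and f g :: "'a \<Rightarrow> real"
  assume C: "1-lipschitz_on UNIV C \<and> C 0 = 0"
  have contr: "Ei (\<lambda>x\<in>Y. f x + C (g x)) + Ei (\<lambda>x\<in>Y. f x - C (g x))
      \<le> Ei (\<lambda>x\<in>Y. f x + g x) + Ei (\<lambda>x\<in>Y. f x - g x)"
    if "contractions_operate Y Ei" for Y and Ei :: "('a \<Rightarrow> real) \<Rightarrow> ennreal"
  proof -
    have "\<forall>f\<in>fun_space Y. \<forall>g\<in>fun_space Y.
        Ei (\<lambda>x\<in>Y. f x + C (g x)) + Ei (\<lambda>x\<in>Y. f x - C (g x))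
        \<le> Ei (\<lambda>x\<in>Y. f x + g x) + Ei (\<lambda>x\<in>Y. f x - g x)"
      using that C unfolding contractions_operate_def by blast
    from this[rule_format, of "restrict f Y" "restrict g Y"] show ?thesis
      by (simp cong: restrict_cong)
  qed
  let ?a = "f \<xi>1 - f \<xi>2" and ?b = "g \<xi>1 - g \<xi>2" and ?c = "C (g \<xi>1) - C (g \<xi>2)"
  have "\<bar>?c\<bar> \<le> \<bar>?b\<bar>"
    using C unfolding lipschitz_on_def dist_real_def by auto
  then have "?c\<^sup>2 \<le> ?b\<^sup>2"
    by (simp add: abs_le_square_iff)
  then have "(?a + ?c)\<^sup>2 + (?a - ?c)\<^sup>2 \<le> (?a + ?b)\<^sup>2 + (?a - ?b)\<^sup>2"
    by (simp add: power2_sum power2_diff)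
  then have "1 / (4 * \<epsilon>) * ((?a + ?c)\<^sup>2 + (?a - ?c)\<^sup>2)
      \<le> 1 / (4 * \<epsilon>) * ((?a + ?b)\<^sup>2 + (?a - ?b)\<^sup>2)"
    using \<epsilon> by (intro mult_left_mono) auto
  then have "coupling (?a + ?c) + coupling (?a - ?c) \<le> coupling (?a + ?b) + coupling (?a - ?b)"
    by (simp only: power2_abs distrib_left)
  then have coup: "ennreal (coupling (?a + ?c)) + ennreal (coupling (?a - ?c))
      \<le> ennreal (coupling (?a + ?b)) + ennreal (coupling (?a - ?b))"
    using coupling_nonneg
    by (simp add: ennreal_plus[symmetric] del: ennreal_plus)
  \<comment> \<open>Brings the gaps of all four functions into the form used in
    \<open>coup\<close>.\<close>
  have diffs: "(f \<xi>1 + p) - (f \<xi>2 + q) = ?a + (p - q)" "(f \<xi>1 - p) - (f \<xi>2 - q) = ?a - (p - q)"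
    for p q by simp_all
  have "E (\<lambda>x\<in>X. f x + C (g x)) + E (\<lambda>x\<in>X. f x - C (g x))
    = (E1 (\<lambda>x\<in>X1. f x + C (g x)) + E1 (\<lambda>x\<in>X1. f x - C (g x)))
    + (E2 (\<lambda>x\<in>X2. f x + C (g x)) + E2 (\<lambda>x\<in>X2. f x - C (g x)))
    + (ennreal (coupling (?a + ?c)) + ennreal (coupling (?a - ?c)))"
    unfolding E_restrict diffs by (simp only: ac_simps)
  also have "\<dots> \<le> (E1 (\<lambda>x\<in>X1. f x + g x) + E1 (\<lambda>x\<in>X1. f x - g x))
    + (E2 (\<lambda>x\<in>X2. f x + g x) + E2 (\<lambda>x\<in>X2. f x - g x))
    + (ennreal (coupling (?a + ?b)) + ennreal (coupling (?a - ?b)))"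
    by (intro add_mono contr coup form1D form2D)
  also have "\<dots> = E (\<lambda>x\<in>X. f x + g x) + E (\<lambda>x\<in>X. f x - g x)"
    unfolding E_restrict diffs by (simp only: ac_simps)
  finally show "E (\<lambda>x\<in>X. f x + C (g x)) + E (\<lambda>x\<in>X. f x - C (g x))
      \<le> E (\<lambda>x\<in>X. f x + g x) + E (\<lambda>x\<in>X. f x - g x)" .
qed

text \<open>All three summands are nonnegative, so each is at most 1. The last bound controls the
  passage between the two components.\<close>

lemma energy_le_one_bounds:
  assumes f: "f \<in> fun_space X" and "E f \<le> 1"
  shows "E1 (restrict f X1) \<le> 1" "E2 (restrict f X2) \<le> 1" "\<bar>f \<xi>1 - f \<xi>2\<bar> \<le> sqrt (4 * \<epsilon>)"
proof -
  have le: "E1 (restrict f X1) + E2 (restrict f X2) + ennreal (coupling (f \<xi>1 - f \<xi>2)) \<le> 1"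
    using assms E_eq by simp
  show "E1 (restrict f X1) \<le> 1"
    using le by (rule order.trans[rotated]) (simp add: add.assoc)
  show "E2 (restrict f X2) \<le> 1"
    using le by (rule order.trans[rotated]) (simp add: add.commute add.left_commute)
  have "ennreal (coupling (f \<xi>1 - f \<xi>2)) \<le> 1"
    using le by (rule order.trans[rotated]) simp
  then have "coupling (f \<xi>1 - f \<xi>2) \<le> 1"
    using ennreal_le_1 by blast
  then have "\<bar>f \<xi>1 - f \<xi>2\<bar>\<^sup>2 \<le> 4 * \<epsilon>"
    using \<epsilon> by (simp add: field_simps)
  then show "\<bar>f \<xi>1 - f \<xi>2\<bar> \<le> sqrt (4 * \<epsilon>)"
    by (rule real_le_rsqrt)
qed

text \<open>Boundedness of differences over the unit energy ball is a transitive relation between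
  points. It holds inside each component by finiteness of its own resistance, and between \<xi>1 and
  \<xi>2 by the coupling term.\<close>

lemma resistance_finite:
  assumes x: "x \<in> X" and y: "y \<in> X"
  shows "resistance X E x y < \<infinity>"
proof -
  define B where "B x y \<longleftrightarrow> (\<exists>M. \<forall>f\<in>fun_space X. E f \<le> 1 \<longrightarrow> f x - f y \<le> M)" for x y
  have trans: "B x z" if "B x y" "B y z" for x y z
  proof -
    from that obtain M N where "\<forall>f\<in>fun_space X. E f \<le> 1 \<longrightarrow> f x - f y \<le> M"
      "\<forall>f\<in>fun_space X. E f \<le> 1 \<longrightarrow> f y - f z \<le> N" unfolding B_def by blast
    then have "\<forall>f\<in>fun_space X. E f \<le> 1 \<longrightarrow> f x - f z \<le> M + N" by fastforce
    then show ?thesis unfolding B_def ..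
  qed
  have B1: "B x y" if xy: "x \<in> X1" "y \<in> X1" for x y
  proof -
    obtain M where M: "\<forall>f\<in>fun_space X1. E1 f \<le> 1 \<longrightarrow> f x - f y \<le> M"
      using form1D(6)[OF xy] unfolding resistance_finite_iff[where E = E1, OF form1D(3)] by blast
    have "f x - f y \<le> M" if f: "f \<in> fun_space X" "E f \<le> 1" for f
      using M[rule_format, of "restrict f X1"] energy_le_one_bounds(1)[OF f] xy
      by simp
    then show ?thesis unfolding B_def by blast
  qed
  have B2: "B x y" if xy: "x \<in> X2" "y \<in> X2" for x y
  proof -
    obtain M where M: "\<forall>f\<in>fun_space X2. E2 f \<le> 1 \<longrightarrow> f x - f y \<le> M"
      using form2D(6)[OF xy] unfolding resistance_finite_iff[where E = E2, OF form2D(3)] by blast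
    have "f x - f y \<le> M" if f: "f \<in> fun_space X" "E f \<le> 1" for f
      using M[rule_format, of "restrict f X2"] energy_le_one_bounds(2)[OF f] xy
      by simp
    then show ?thesis unfolding B_def by blast
  qed
  have "f \<xi>1 - f \<xi>2 \<le> sqrt (4 * \<epsilon>)" "f \<xi>2 - f \<xi>1 \<le> sqrt (4 * \<epsilon>)"
    if "f \<in> fun_space X" "E f \<le> 1" for f
    using energy_le_one_bounds(3)[OF that] by linarith+
  then have "B \<xi>1 \<xi>2" "B \<xi>2 \<xi>1" unfolding B_def by blast+
  \<comment> \<open>If the points lie in different components, the chain runs through both \<xi>1
    and \<xi>2, in either direction.\<close>
  then have "B x y"
    using x y B1 B2 \<xi>1 \<xi>2 trans by (metis UnE)
  then show ?thesis
    unfolding resistance_finite_iff[where E = E, OF E_zero] B_def .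
qed

lemma form: "nonlinear_resistance_form X E"
  unfolding nonlinear_resistance_form_def
  using convex E_zero lsc resistance_finite contractions \<xi>1 by blast

section \<open>The t-resistance across the coupling\<close>

text \<open>Finiteness passes to each nonnegative summand, after which \<open>enn2real\<close> is
  additive. The estimates below thus become real arithmetic.\<close>

lemma E_finite:
  assumes f: "f \<in> fun_space X" and "E f < top"
  shows "E1 (restrict f X1) < top" "E2 (restrict f X2) < top"
    "enn2real (E f) = enn2real (E1 (restrict f X1)) + enn2real (E2 (restrict f X2))
       + coupling (f \<xi>1 - f \<xi>2)"
proof -
  have Ef: "E f = E1 (restrict f X1) + E2 (restrict f X2) + ennreal (coupling (f \<xi>1 - f \<xi>2))"
    using E_eq[OF f] .
  show fin: "E1 (restrict f X1) < top" "E2 (restrict f X2) < top"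
    using \<open>E f < top\<close> unfolding Ef by auto
  show "enn2real (E f) = enn2real (E1 (restrict f X1)) + enn2real (E2 (restrict f X2))
       + coupling (f \<xi>1 - f \<xi>2)"
    unfolding Ef using fin coupling_nonneg by (simp add: enn2real_plus)
qed

text \<open>Every competitor for \<open>E\<close> restricts to competitors for \<open>E1\<close> and
  \<open>E2\<close>, and the gap contributes at most the maximum of
  \<open>t * d - coupling d\<close>.\<close>

lemma t_resistance_le:
  assumes "x1 \<in> X1" and "x2 \<in> X2"
  shows "t_resistance X E t x1 x2
    \<le> t_resistance X1 E1 t x1 \<xi>1 + t_resistance X2 E2 t \<xi>2 x2 + ereal (\<epsilon> * t\<^sup>2)"
  unfolding t_resistance_eq_SUP_finite[where E = E, OF E_zero]
proof (rule SUP_least)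
  fix f assume "f \<in> {f \<in> fun_space X. E f < top}"
  then have f: "f \<in> fun_space X" "E f < top" by auto
  let ?d = "f \<xi>1 - f \<xi>2"
  \<comment> \<open>Completing the square gives
    \<open>t * d - coupling d \<le> \<epsilon> * t\<^sup>2\<close>.\<close>
  have "0 \<le> (?d - 2 * \<epsilon> * t)\<^sup>2 / (4 * \<epsilon>)"
    using \<epsilon> by simp
  also have "\<dots> = coupling ?d - t * ?d + \<epsilon> * t\<^sup>2"
    using \<epsilon> by (simp add: field_simps power2_eq_square)
  finally have "t * (f x1 - f x2) - enn2real (E f)
      \<le> (t * (f x1 - f \<xi>1) - enn2real (E1 (restrict f X1)))
      + (t * (f \<xi>2 - f x2) - enn2real (E2 (restrict f X2))) + \<epsilon> * t\<^sup>2"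
    unfolding E_finite(3)[OF f] by (simp add: algebra_simps)
  then have "ereal (t * (f x1 - f x2) - enn2real (E f))
      \<le> ereal (t * (f x1 - f \<xi>1) - enn2real (E1 (restrict f X1)))
      + ereal (t * (f \<xi>2 - f x2) - enn2real (E2 (restrict f X2))) + ereal (\<epsilon> * t\<^sup>2)"
    by simp
  also have "\<dots> \<le> t_resistance X1 E1 t x1 \<xi>1 + t_resistance X2 E2 t \<xi>2 x2 + ereal (\<epsilon> * t\<^sup>2)"
    unfolding t_resistance_eq_SUP_finite[where E = E1, OF form1D(3)]
      t_resistance_eq_SUP_finite[where E = E2, OF form2D(3)]
    using assms \<xi>1 \<xi>2 E_finite(1,2)[OF f]
    by (intro add_mono SUP_upper2[of "restrict f X1"] SUP_upper2[of "restrict f X2"]) auto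
  finally show "ereal (t * (f x1 - f x2) - enn2real (E f)) \<le> \<dots>" .
qed

text \<open>Arbitrary finite-energy competitors on the two components are glued into one for
  \<open>E\<close>. Shifting \<open>f2\<close> by a constant keeps its differences and does not
  raise its energy, so the gap can be set to its optimal value.\<close>

lemma glued_le_t_resistance:
  assumes x1: "x1 \<in> X1" and x2: "x2 \<in> X2"
    and f1: "f1 \<in> fun_space X1" "E1 f1 < top" and f2: "f2 \<in> fun_space X2" "E2 f2 < top"
  shows "ereal ((t * (f1 x1 - f1 \<xi>1) - enn2real (E1 f1))
      + (t * (f2 \<xi>2 - f2 x2) - enn2real (E2 f2)) + \<epsilon> * t\<^sup>2) \<le> t_resistance X E t x1 x2"
proof -
  \<comment> \<open>Chosen so that the glued function has gap \<open>2 * \<epsilon> * t\<close>, the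
    maximizer of \<open>t * d - coupling d\<close>.\<close>
  define c where "c = f1 \<xi>1 - f2 \<xi>2 - 2 * \<epsilon> * t"
  define f where "f = (\<lambda>x\<in>X. if x \<in> X1 then f1 x else f2 x + c)"
  have f: "f \<in> fun_space X" by (simp add: f_def)
  have not1: "x \<notin> X1" if "x \<in> X2" for x using that disj by auto
  have r1: "restrict f X1 = f1"
    using f1(1) by (auto simp: f_def fun_eq_iff PiE_def extensional_def)
  have r2: "restrict f X2 = (\<lambda>x\<in>X2. f2 x + c)"
    by (auto simp: f_def fun_eq_iff not1)
  have le2: "E2 (restrict f X2) \<le> E2 f2"
    unfolding r2 by (intro energy_add_const_le form2D const2 f2)
  have Ef: "E f = E1 f1 + E2 (restrict f X2) + ennreal (coupling (f \<xi>1 - f \<xi>2))"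
    using E_eq[OF f] r1 by simp
  have fin: "E f < top"
    unfolding Ef using f1 le2 f2(2) by (auto intro: le_less_trans)
  have d: "f \<xi>1 - f \<xi>2 = 2 * \<epsilon> * t"
    using \<xi>1 \<xi>2 by (simp add: f_def not1 c_def)
  have "coupling (2 * \<epsilon> * t) = \<epsilon> * t\<^sup>2"
    using \<epsilon> by (simp add: power2_eq_square field_simps)
  then have "enn2real (E f) = enn2real (E1 f1) + enn2real (E2 (restrict f X2)) + \<epsilon> * t\<^sup>2"
    using E_finite(3)[OF f fin] unfolding d r1 by simp
  also have "\<dots> \<le> enn2real (E1 f1) + enn2real (E2 f2) + \<epsilon> * t\<^sup>2"
    using enn2real_mono[OF le2 f2(2)] by simp
  \<comment> \<open>The gap adds \<open>2 * \<epsilon> * t\<^sup>2\<close> to the linear part and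
    the coupling costs \<open>\<epsilon> * t\<^sup>2\<close>, which leaves the stated term.\<close>
  finally have "(t * (f1 x1 - f1 \<xi>1) - enn2real (E1 f1))
      + (t * (f2 \<xi>2 - f2 x2) - enn2real (E2 f2)) + \<epsilon> * t\<^sup>2
      \<le> t * (f x1 - f x2) - enn2real (E f)"
    using x1 x2 by (simp add: f_def not1 c_def power2_eq_square algebra_simps)
  also have "ereal \<dots> \<le> t_resistance X E t x1 x2"
    unfolding t_resistance_eq_SUP_finite[where E = E, OF E_zero]
    using f fin by (intro SUP_upper) auto
  finally show ?thesis by simp
qed

text \<open>The two competitors in \<open>glued_le_t_resistance\<close> vary independently, so the
  sum of suprema is an iterated supremum of sums, each bounded by that lemma.\<close>

lemma t_resistance_ge:
  assumes "x1 \<in> X1" and "x2 \<in> X2"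
  shows "t_resistance X1 E1 t x1 \<xi>1 + t_resistance X2 E2 t \<xi>2 x2 + ereal (\<epsilon> * t\<^sup>2)
    \<le> t_resistance X E t x1 x2"
proof -
  let ?D1 = "{f \<in> fun_space X1. E1 f < top}" and ?D2 = "{f \<in> fun_space X2. E2 f < top}"
  let ?g1 = "\<lambda>f. ereal (t * (f x1 - f \<xi>1) - enn2real (E1 f))"
  let ?g2 = "\<lambda>f. ereal (t * (f \<xi>2 - f x2) - enn2real (E2 f))"
  have ne1: "?D1 \<noteq> {}"
    using form1D(3) by (auto intro!: exI[of _ "\<lambda>x\<in>X1. 0"])
  have mem2: "(\<lambda>x\<in>X2. 0) \<in> ?D2"
    using form2D(3) by auto
  then have ne2: "?D2 \<noteq> {}" by blast
  \<comment> \<open>The zero function keeps this supremum above -\<infinity>, as required for moving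
    an \<open>ereal\<close> summand into a supremum.\<close>
  have "?g2 (\<lambda>x\<in>X2. 0) \<le> Sup (?g2 ` ?D2)"
    using mem2 by (intro SUP_upper)
  then have ninf: "Sup (?g2 ` ?D2) + ereal (\<epsilon> * t\<^sup>2) \<noteq> -\<infinity>"
    by auto
  have "t_resistance X1 E1 t x1 \<xi>1 + t_resistance X2 E2 t \<xi>2 x2 + ereal (\<epsilon> * t\<^sup>2)
      = (SUP f1\<in>?D1. ?g1 f1) + ((SUP f2\<in>?D2. ?g2 f2) + ereal (\<epsilon> * t\<^sup>2))"
    unfolding t_resistance_eq_SUP_finite[where E = E1, OF form1D(3)]
      t_resistance_eq_SUP_finite[where E = E2, OF form2D(3)]
    by (simp add: add.assoc)
  also have "\<dots> = (SUP f1\<in>?D1. ?g1 f1 + ((SUP f2\<in>?D2. ?g2 f2) + ereal (\<epsilon> * t\<^sup>2)))"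
    by (rule SUP_ereal_add_left[OF ne1 ninf, symmetric])
  also have "\<dots> = (SUP f1\<in>?D1. SUP f2\<in>?D2. ?g1 f1 + (?g2 f2 + ereal (\<epsilon> * t\<^sup>2)))"
    using ne2 by (simp add: SUP_ereal_add_left SUP_ereal_add_right del: plus_ereal.simps)
  also have "\<dots> \<le> t_resistance X E t x1 x2"
    using glued_le_t_resistance[OF assms]
    by (intro SUP_least) (simp add: add.assoc)
  finally show ?thesis .
qed

end

theorem theorem4p20:
  fixes X1 X2 :: "'a set"
    and E1 E2 E :: "('a \<Rightarrow> real) \<Rightarrow> ennreal"
    and \<xi>1 \<xi>2 :: 'a
    and \<epsilon> :: real
  assumes "X1 \<noteq> {}" and "X2 \<noteq> {}" and "X1 \<inter> X2 = {}"
    and "nonlinear_resistance_form X1 E1" and "nonlinear_resistance_form X2 E2"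
    and "const_funs X1 \<subseteq> form_kernel X1 E1" and "const_funs X2 \<subseteq> form_kernel X2 E2"
    and "\<xi>1 \<in> X1" and "\<xi>2 \<in> X2" and "\<epsilon> > 0"
    and "\<And>f. f \<in> fun_space (X1 \<union> X2) \<Longrightarrow>
           E f = E1 (restrict f X1) + E2 (restrict f X2)
                 + ennreal (1 / (4 * \<epsilon>) * \<bar>f \<xi>1 - f \<xi>2\<bar>\<^sup>2)"
  shows "nonlinear_resistance_form (X1 \<union> X2) E
    \<and> const_funs (X1 \<union> X2) \<subseteq> form_kernel (X1 \<union> X2) E
    \<and> (\<forall>x1\<in>X1. \<forall>x2\<in>X2. \<forall>t>0.
         t_resistance (X1 \<union> X2) E t x1 x2
           = t_resistance X1 E1 t x1 \<xi>1 + t_resistance X2 E2 t \<xi>2 x2 + ereal (\<epsilon> * t\<^sup>2))"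
proof -
  interpret coupled_forms X1 X2 E1 E2 E \<xi>1 \<xi>2 \<epsilon>
    using assms by unfold_locales auto
  show ?thesis
    by (intro conjI ballI allI impI form const_funs_subset antisym t_resistance_le t_resistance_ge)
qed

end
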